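(* Let $f:\mathbb{R}^n\times\mathbb{R}^m\to\mathbb{R}^n$ be continuous and consider the system $x(t+1)=f(x(t),u(t))$, $t\in\mathbb{Z}^+$. Let $\hat f^{\ell}:\mathbb{R}^n\times\mathbb{R}^m\to\mathbb{R}^n$, $\ell\in\mathbb{Z}^+$, be defined by $\hat f^0(x,u)=x$, $\hat f^1(x,u)=f(x,u)$ and $\hat f^{\ell+1}(x,u)=f(\hat f^{\ell}(x,u),0)$ for $\ell\ge 1$. Then the system is immersible into a linear system of the form $\Sigma(A,B,C)$ if and only if there exist a finite $k\in\mathbb{Z}^+$, matrices $\{\alpha_\ell\in\mathbb{R}^{n\times n}\}_{\ell=0}^{k}$ and matrices $\{b_\ell\in\mathbb{R}^{n\times m}\}_{\ell=1}^{k+1}$ such that, for all $(x,u)\in\mathbb{R}^n\times\mathbb{R}^m$, $$\hat f^{k+1}(x,0)=\sum_{\ell=0}^{k}\alpha_\ell\,\hat f^{\ell}(x,0),$$ $$\hat f^{\ell}(x,u)=\hat f^{\ell}(x,0)+b_\ell u,\qquad \ell=1,2,\dots,k+1.$$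
   Context: $\mathbb{Z}^+$ denotes the set of non-negative integers (including $0$). For a control sequence $\pmb{u}=\{u(0),u(1),\dots\}$ with values in $\mathbb{R}^m$, $\phi(t;x,\pmb{u})$ denotes the solution at time $t$ of $x(t+1)=f(x(t),u(t))$ with initial state $x$ at time $0$. For $\tilde n>n$, $A\in\mathbb{R}^{\tilde n\times\tilde n}$, $B\in\mathbb{R}^{\tilde n\times m}$, $C\in\mathbb{R}^{n\times\tilde n}$, $\Sigma(A,B,C)$ denotes the linear system $\tilde x(t+1)=A\tilde x(t)+Bu(t)$, $\tilde y(t)=C\tilde x(t)$, $t\in\mathbb{Z}^+$, and $\tilde\phi(t;\tilde x,\pmb{u})$ denotes its state solution at time $t$ with initial state $\tilde x$ at time $0$. The system $x(t+1)=f(x(t),u(t))$ is immersible into $\Sigma(A,B,C)$ if there exists a map $T:\mathbb{R}^n\to\mathbb{R}^{\tilde n}$ such that for every initial state $x\in\mathbb{R}^n$ and every control sequence $\pmb{u}$, $\phi(t;x,\pmb{u})=C\tilde\phi(t;T(x),\pmb{u})$ for all $t\in\mathbb{Z}^+$. "Immersible into a linear system of the form $\Sigma(A,B,C)$" means immersible into $\Sigma(A,B,C)$ for some $\tilde n>n$ and some matrices $A\in\mathbb{R}^{\tilde n\times\tilde n}$, $B\in\mathbb{R}^{\tilde n\times m}$, $C\in\mathbb{R}^{n\times\tilde n}$. *)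

theory Defs
  imports "HOL-Analysis.Analysis"
begin

text \<open>\<open>traj F x u t\<close> is the state at time \<open>t\<close> of \<open>x(t+1) = F(x(t), u(t))\<close> started in \<open>x\<close> at time \<open>0\<close>.
  It serves both for the nonlinear system and for the linear one.\<close>

primrec traj :: "('x \<Rightarrow> 'u \<Rightarrow> 'x) \<Rightarrow> 'x \<Rightarrow> (nat \<Rightarrow> 'u) \<Rightarrow> nat \<Rightarrow> 'x" where
  "traj F x u 0 = x"
| "traj F x u (Suc t) = F (traj F x u t) (u t)"

text \<open>The dimension \<open>N\<close> of the linear system has to be quantified inside a formula, so it cannot be a
  type. Its state space is the set \<open>{..<N} \<rightarrow>\<^sub>E UNIV\<close> of real tuples with indices \<open>0, \<dots>, N - 1\<close>, and the
  matrices \<open>A\<close> (\<open>N \<times> N\<close>), \<open>B\<close> (\<open>N \<times> m\<close>), \<open>C\<close> (\<open>n \<times> N\<close>) are families of entries, of which only those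
  whose indices lie below \<open>N\<close>, wherever the index is a natural number, are ever used.\<close>

definition lin_step ::
  "nat \<Rightarrow> (nat \<Rightarrow> nat \<Rightarrow> real) \<Rightarrow> (nat \<Rightarrow> 'm::finite \<Rightarrow> real) \<Rightarrow> (nat \<Rightarrow> real) \<Rightarrow> real^'m \<Rightarrow> (nat \<Rightarrow> real)"
  where "lin_step N A B x u = (\<lambda>i\<in>{..<N}. (\<Sum>j<N. A i j * x j) + (\<Sum>p\<in>UNIV. B i p * u $ p))"

definition lin_output ::
  "nat \<Rightarrow> ('n::finite \<Rightarrow> nat \<Rightarrow> real) \<Rightarrow> (nat \<Rightarrow> real) \<Rightarrow> real^'n"
  where "lin_output N C x = (\<chi> i. \<Sum>j<N. C i j * x j)"

definition immersible_into ::
  "(real^'n::finite \<Rightarrow> real^'m::finite \<Rightarrow> real^'n) \<Rightarrow> nat \<Rightarrow> (nat \<Rightarrow> nat \<Rightarrow> real) \<Rightarrow>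
    (nat \<Rightarrow> 'm \<Rightarrow> real) \<Rightarrow> ('n \<Rightarrow> nat \<Rightarrow> real) \<Rightarrow> bool"
  where "immersible_into f N A B C \<longleftrightarrow>
    (\<exists>T \<in> UNIV \<rightarrow> ({..<N} \<rightarrow>\<^sub>E UNIV).
      \<forall>x u t. traj f x u t = lin_output N C (traj (lin_step N A B) (T x) u t))"

definition immersible :: "(real^'n::finite \<Rightarrow> real^'m::finite \<Rightarrow> real^'n) \<Rightarrow> bool"
  where "immersible f \<longleftrightarrow> (\<exists>N > CARD('n). \<exists>A B C. immersible_into f N A B C)"

fun fhat :: "(real^'n::finite \<Rightarrow> real^'m::finite \<Rightarrow> real^'n) \<Rightarrow> nat \<Rightarrow> real^'n \<Rightarrow> real^'m \<Rightarrow> real^'n" where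
  "fhat f 0 x u = x"
| "fhat f (Suc 0) x u = f x u"
| "fhat f (Suc (Suc l)) x u = f (fhat f (Suc l) x u) 0"

end

theory Submission
  imports Defs "HOL-Library.Function_Algebras"
begin

text \<open>Both conditions say that the functions \<open>x \<mapsto> fhat f l x 0\<close>, the states reached under zero
  input, evolve linearly along the system.

  If the system is immersed by \<open>T\<close> into \<open>\<Sigma>(A, B, C)\<close> of dimension \<open>N\<close>, then \<open>fhat f l x u\<close> is the
  output at time \<open>l\<close> for the input sequence \<open>u, 0, 0, \<dots>\<close>, so that
  \<open>fhat f l x u = C A\<^sup>l T(x) + C A\<^sup>l\<^sup>-\<^sup>1 B u\<close> for \<open>l \<ge> 1\<close> (\<open>immersible_into_fhat\<close>). This is the affine
  dependence on \<open>u\<close>, with \<open>b\<^sub>l = C A\<^sup>l\<^sup>-\<^sup>1 B\<close>. For the recurrence, consider one row \<open>c\<close> of \<open>C\<close>: the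
  \<open>N + 1\<close> row vectors \<open>c, c A, \<dots>, c A\<^sup>N\<close> lie in a space of dimension \<open>N\<close>, so some \<open>c A\<^sup>d\<close> is a
  combination of its predecessors; multiplication by \<open>A\<^sup>N\<^sup>-\<^sup>d\<close> turns this into a relation that
  expresses \<open>c A\<^sup>N\<close> (\<open>row_power_recurrence\<close>). The order \<open>N\<close> is then the same for all rows, so the
  scalar relations combine into one recurrence with diagonal matrices \<open>\<alpha>\<^sub>l\<close> and \<open>k = N - 1\<close>.

  Conversely, one step of the system shifts the zero-input states:
  \<open>fhat f l (f x u) 0 = fhat f (l + 1) x u = fhat f (l + 1) x 0 + b\<^sub>l\<^sub>+\<^sub>1 u\<close> for \<open>l \<le> k\<close>, and for
  \<open>l = k\<close> the recurrence rewrites the right-hand side in terms of \<open>fhat f 0 x 0, \<dots>, fhat f k x 0\<close>.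
  So the stacked vector of these states has linear dynamics, and its block \<open>l = 0\<close> is the state
  \<open>x\<close> itself (\<open>immersible_if_recurrence\<close>).\<close>

section \<open>Pulse responses\<close>

definition pulse :: "'u \<Rightarrow> nat \<Rightarrow> 'u::zero" where
  "pulse u t = (if t = 0 then u else 0)"

lemma pulse_simps [simp]: "pulse u 0 = u" "pulse u (Suc t) = 0"
  by (simp_all add: pulse_def)

lemma fhat_eq_traj_pulse: "fhat f l x u = traj f x (pulse u) l"
  by (induction f l x u rule: fhat.induct) simp_all

text \<open>The recursion of \<open>fhat\<close> appends a zero-input step at the end; the shift property of the
  zero-input states needs the first step to be split off instead.\<close>

lemma fhat_Suc: "fhat f (Suc l) x u = fhat f l (f x u) 0"
proof (induction l)
  case (Suc l)
  then show ?case by (cases l) simp_all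
qed simp

section \<open>Sums of functions and sums with one nonzero term\<close>

lemma sum_of_bool_eq_mult:
  fixes h :: "'a \<Rightarrow> real"
  assumes "finite S" and "q \<in> S"
  shows "(\<Sum>r\<in>S. of_bool (r = q) * h r) = h q"
proof -
  have "S \<inter> {r. r = q} = {q}" using assms by auto
  then show ?thesis using assms by (simp add: sum_of_bool_mult_eq)
qed

lemma sum_fun_apply: "(\<Sum>i\<in>S. h i) j = (\<Sum>i\<in>S. h i j)" for h :: "'a \<Rightarrow> 'b \<Rightarrow> real"
  by (induction S rule: infinite_finite_induct) simp_all

section \<open>Linear recurrences for the rows of an observability matrix\<close>

text \<open>Vectors of dimension \<open>N\<close> are represented by real sequences that vanish from index \<open>N\<close> on, so
  that a dimension that is not fixed by a type can be treated inside one vector space.\<close>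

interpretation seq: vector_space "\<lambda>(a::real) (v::nat \<Rightarrow> real) j. a * v j"
  by unfold_locales (auto simp: fun_eq_iff algebra_simps)

lemma seq_in_span_unit_vectors:
  assumes "\<And>j. j \<ge> N \<Longrightarrow> v j = 0"
  shows "v \<in> seq.span ((\<lambda>i j. of_bool (j = i)) ` {..<N})"
proof -
  have "v = (\<Sum>i<N. (\<lambda>j. v i * of_bool (j = i)))"
  proof
    fix j
    have "(\<Sum>i<N. v i * of_bool (j = i)) = v j"
    proof (cases "j < N")
      case True
      then show ?thesis
        using sum_of_bool_eq_mult[of "{..<N}" j v] by (simp add: mult.commute eq_commute)
    next
      case False
      then show ?thesis using assms[of j] by (auto intro!: sum.neutral)
    qed
    then show "v j = (\<Sum>i<N. (\<lambda>j. v i * of_bool (j = i))) j"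
      by (simp add: sum_fun_apply)
  qed
  also have "\<dots> \<in> seq.span ((\<lambda>i j. of_bool (j = i)) ` {..<N})"
    by (intro seq.span_sum seq.span_scale seq.span_base) auto
  finally show ?thesis .
qed

text \<open>The coefficients are indexed by the position in the family and not by the vector, since the
  family may contain repetitions.\<close>

lemma seq_span_image_coefficients:
  fixes v :: "nat \<Rightarrow> nat \<Rightarrow> real"
  assumes "w \<in> seq.span (v ` {..<d})"
  shows "\<exists>a. \<forall>j. w j = (\<Sum>l<d. a l * v l j)"
  using assms
proof (induction rule: seq.span_induct_alt)
  case base
  show ?case by (rule exI[of _ "\<lambda>_. 0"]) simp
next
  case (step r y w)
  then obtain m a where m: "m < d" "y = v m" and a: "\<And>j. w j = (\<Sum>l<d. a l * v l j)"
    by auto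
  have "((\<lambda>j. r * y j) + w) j = (\<Sum>l<d. (of_bool (l = m) * r + a l) * v l j)" for j
    using m sum_of_bool_eq_mult[of "{..<d}" m "\<lambda>l. r * v l j"]
    by (simp add: a distrib_right sum.distrib mult.assoc)
  then show ?case by (intro exI[of _ "\<lambda>l. of_bool (l = m) * r + a l"]) blast
qed

text \<open>If no vector depended on its predecessors, \<open>v 0, \<dots>, v N\<close> would be \<open>N + 1\<close> independent vectors
  in the span of \<open>N\<close> unit vectors. Only the entries below \<open>N\<close> are compared.\<close>

lemma exists_dependence_on_predecessors:
  fixes v :: "nat \<Rightarrow> nat \<Rightarrow> real"
  shows "\<exists>d\<le>N. \<exists>a. \<forall>j<N. v d j = (\<Sum>l<d. a l * v l j)"
proof -
  define w where "w l j = (if j < N then v l j else 0)" for l j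
  have "\<exists>d\<le>N. w d \<in> seq.span (w ` {..<d})"
  proof (rule ccontr)
    assume "\<not> ?thesis"
    then have new: "w d \<notin> seq.span (w ` {..<d})" if "d \<le> N" for d
      using that by blast
    have "seq.independent (w ` {..<m}) \<and> card (w ` {..<m}) = m" if "m \<le> Suc N" for m
      using that
    proof (induction m)
      case (Suc m)
      have "w m \<notin> w ` {..<m}"
        using new[of m] Suc.prems seq.span_base by auto
      then show ?case
        using Suc new[of m] by (simp add: lessThan_Suc seq.independent_insert)
    qed (simp add: seq.independent_empty)
    then have ind: "seq.independent (w ` {..<Suc N})" and card: "card (w ` {..<Suc N}) = Suc N"
      by blast+
    have "w ` {..<Suc N} \<subseteq> seq.span ((\<lambda>i j. of_bool (j = i)) ` {..<N})"
      by (auto intro!: seq_in_span_unit_vectors simp: w_def)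
    from seq.independent_span_bound[OF _ ind this]
    have "Suc N \<le> card ((\<lambda>i j. of_bool (j = i) :: real) ` {..<N})"
      using card by simp
    also have "\<dots> \<le> N"
      using card_image_le[of "{..<N}"] by simp
    finally show False by simp
  qed
  then obtain d a where "d \<le> N" and a: "\<And>j. w d j = (\<Sum>l<d. a l * w l j)"
    using seq_span_image_coefficients by blast
  moreover have "v d j = (\<Sum>l<d. a l * v l j)" if "j < N" for j
    using a[of j] that by (simp add: w_def)
  ultimately show ?thesis by blast
qed

text \<open>This is the row vector \<open>c A\<^sup>l\<close>, a row of the observability matrix of the pair \<open>(A, c)\<close>. Entries
  from index \<open>N\<close> on are meaningless.\<close>

primrec row_power :: "nat \<Rightarrow> (nat \<Rightarrow> nat \<Rightarrow> real) \<Rightarrow> (nat \<Rightarrow> real) \<Rightarrow> nat \<Rightarrow> nat \<Rightarrow> real" where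
  "row_power N A c 0 = c"
| "row_power N A c (Suc l) = (\<lambda>j. \<Sum>i<N. row_power N A c l i * A i j)"

text \<open>A relation between the rows \<open>c A\<^sup>l\<close> survives right multiplication by \<open>A\<^sup>s\<close>.\<close>

lemma row_power_recurrence_shift:
  assumes "\<And>j. j < N \<Longrightarrow> row_power N A c d j = (\<Sum>l<d. a l * row_power N A c l j)"
    and "j < N"
  shows "row_power N A c (d + s) j = (\<Sum>l<d. a l * row_power N A c (l + s) j)"
  using \<open>j < N\<close>
proof (induction s arbitrary: j)
  case 0
  then show ?case using assms(1) by simp
next
  case (Suc s)
  have "row_power N A c (d + Suc s) j = (\<Sum>i<N. (\<Sum>l<d. a l * row_power N A c (l + s) i) * A i j)"
    using Suc.IH by simp
  also have "\<dots> = (\<Sum>l<d. \<Sum>i<N. a l * row_power N A c (l + s) i * A i j)"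
    unfolding sum_distrib_right by (rule sum.swap)
  also have "\<dots> = (\<Sum>l<d. a l * row_power N A c (l + Suc s) j)"
    by (simp add: sum_distrib_left mult.assoc)
  finally show ?case .
qed

text \<open>A weak form of the Cayley-Hamilton theorem, for a single row and with coefficients that may
  depend on it. The dependence found first has a degree \<open>d \<le> N\<close> that depends on \<open>c\<close>; it is shifted
  to degree exactly \<open>N\<close> so that several rows can share one order of recurrence.\<close>

lemma row_power_recurrence:
  "\<exists>a. \<forall>j<N. row_power N A c N j = (\<Sum>l<N. a l * row_power N A c l j)"
proof -
  let ?r = "row_power N A c"
  obtain d a where d: "d \<le> N" and a: "\<And>j. j < N \<Longrightarrow> ?r d j = (\<Sum>l<d. a l * ?r l j)"
    using exists_dependence_on_predecessors[of N ?r] by blast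
  define s where "s = N - d"
  define a' where "a' l = (if l < s then 0 else a (l - s))" for l
  have "?r N j = (\<Sum>l<N. a' l * ?r l j)" if "j < N" for j
  proof -
    have "?r N j = (\<Sum>l<d. a l * ?r (l + s) j)"
      using row_power_recurrence_shift[OF a that, of s] d by (simp add: s_def)
    also have "\<dots> = (\<Sum>l\<in>{s..<N}. a' l * ?r l j)"
      by (rule sum.reindex_bij_witness[of _ "\<lambda>l. l - s" "\<lambda>l. l + s"])
        (use d in \<open>auto simp: s_def a'_def\<close>)
    also have "\<dots> = (\<Sum>l<N. a' l * ?r l j)"
      by (rule sum.mono_neutral_left) (auto simp: a'_def)
    finally show ?thesis .
  qed
  then show ?thesis by blast
qed

section \<open>From an immersion to the recurrence and the affine input dependence\<close>

text \<open>Applying \<open>c A\<^sup>l\<close> to \<open>A X + B u\<close> moves one factor \<open>A\<close> into the row and leaves an input term.\<close>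

lemma row_power_lin_step:
  "(\<Sum>j<N. row_power N A c l j * lin_step N A B X u j) =
    (\<Sum>j<N. row_power N A c (Suc l) j * X j) + (\<Sum>p\<in>UNIV. (\<Sum>j<N. row_power N A c l j * B j p) * u $ p)"
proof -
  let ?r = "row_power N A c"
  have "(\<Sum>j<N. ?r l j * lin_step N A B X u j) =
      (\<Sum>j<N. \<Sum>i<N. ?r l j * A j i * X i) + (\<Sum>j<N. \<Sum>p\<in>UNIV. ?r l j * B j p * u $ p)"
    by (simp add: lin_step_def distrib_left sum.distrib sum_distrib_left mult.assoc)
  also have "\<dots> = (\<Sum>i<N. \<Sum>j<N. ?r l j * A j i * X i) + (\<Sum>p\<in>UNIV. \<Sum>j<N. ?r l j * B j p * u $ p)"
    by (rule arg_cong2[where f = "(+)"]; rule sum.swap)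
  also have "\<dots> = (\<Sum>j<N. ?r (Suc l) j * X j) + (\<Sum>p\<in>UNIV. (\<Sum>j<N. ?r l j * B j p) * u $ p)"
    by (simp add: sum_distrib_right)
  finally show ?thesis .
qed

text \<open>In matrix notation, the state at time \<open>t + 1\<close> under a pulse \<open>u\<close> is \<open>A\<^sup>t\<^sup>+\<^sup>1 X + A\<^sup>t B u\<close>. The power
  \<open>A\<^sup>l\<close> in front is there for the induction: splitting off the last step, which has zero input,
  raises \<open>l\<close> by one.\<close>

lemma row_power_pulse_response:
  "(\<Sum>j<N. row_power N A c l j * traj (lin_step N A B) X (pulse u) (Suc t) j) =
    (\<Sum>j<N. row_power N A c (l + Suc t) j * X j) +
    (\<Sum>p\<in>UNIV. (\<Sum>j<N. row_power N A c (l + t) j * B j p) * u $ p)"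
proof (induction t arbitrary: l)
  case 0
  show ?case by (simp add: row_power_lin_step del: row_power.simps)
next
  case (Suc t)
  show ?case
    using Suc.IH[of "Suc l"]
    by (subst traj.simps) (simp add: row_power_lin_step del: row_power.simps traj.simps)
qed

text \<open>Both equations compare the pulse responses of the two systems. The matrix \<open>C A\<^sup>l B\<close> in the second
  one does not depend on \<open>x\<close>, as linearity separates the effect of the initial state from that of
  the input.\<close>

lemma immersible_into_fhat:
  assumes "immersible_into f N A B C"
  obtains T :: "real^'n::finite \<Rightarrow> nat \<Rightarrow> real" where
    "\<And>l x i. fhat f l x (0::real^'m::finite) $ i = (\<Sum>j<N. row_power N A (C i) l j * T x j)"
    "\<And>l x u i. fhat f (Suc l) x u $ i = fhat f (Suc l) x 0 $ i +
      (\<Sum>p\<in>UNIV. (\<Sum>j<N. row_power N A (C i) l j * B j p) * u $ p)"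
proof -
  obtain T where T: "\<And>x u t. traj f x u t = lin_output N C (traj (lin_step N A B) (T x) u t)"
    using assms by (auto simp: immersible_into_def)
  have out: "fhat f l x u $ i =
      (\<Sum>j<N. row_power N A (C i) 0 j * traj (lin_step N A B) (T x) (pulse u) l j)" for l x u i
    by (simp add: fhat_eq_traj_pulse T lin_output_def)
  have resp: "fhat f (Suc l) x u $ i = (\<Sum>j<N. row_power N A (C i) (Suc l) j * T x j) +
      (\<Sum>p\<in>UNIV. (\<Sum>j<N. row_power N A (C i) l j * B j p) * u $ p)" for l x u i
    unfolding out row_power_pulse_response by simp
  have free: "fhat f l x 0 $ i = (\<Sum>j<N. row_power N A (C i) l j * T x j)" for l x i
  proof (cases l)
    case 0
    then show ?thesis unfolding out by simp
  next
    case (Suc l')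
    then show ?thesis using resp[of l' x 0] by simp
  qed
  show ?thesis
    by (rule that[of T, OF free]) (simp only: resp free)
qed

section \<open>From the recurrence to an immersion\<close>

text \<open>The coordinates \<open>g s\<close> are the components of the map \<open>T\<close>: they evolve linearly along the system
  and determine the state linearly. An arbitrary finite index set \<open>S\<close> is allowed so that blocks
  can be indexed by pairs; an enumeration of \<open>S\<close> transports everything to \<open>{..<N}\<close>.\<close>

lemma immersible_if_linear_coordinates:
  fixes f :: "real^'n::finite \<Rightarrow> real^'m::finite \<Rightarrow> real^'n"
    and g :: "'s \<Rightarrow> real^'n \<Rightarrow> real"
  assumes "finite S" and "card S > CARD('n)"
    and step: "\<And>s x u. s \<in> S \<Longrightarrow>
      g s (f x u) = (\<Sum>r\<in>S. A s r * g r x) + (\<Sum>p\<in>UNIV. B s p * u $ p)"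
    and state: "\<And>x i. x $ i = (\<Sum>r\<in>S. C i r * g r x)"
  shows "immersible f"
proof -
  define N where "N = card S"
  obtain e where e: "bij_betw e {..<N} S"
    using ex_bij_betw_nat_finite[OF \<open>finite S\<close>] by (auto simp: N_def atLeast0LessThan)
  define A' where "A' i j = A (e i) (e j)" for i j
  define B' where "B' i = B (e i)" for i
  define C' where "C' i j = C i (e j)" for i j
  define T where "T x = (\<lambda>j\<in>{..<N}. g (e j) x)" for x
  have "lin_step N A' B' (T x) u = T (f x u)" for x u
  proof
    fix i
    show "lin_step N A' B' (T x) u i = T (f x u) i"
    proof (cases "i < N")
      case True
      then have "e i \<in> S" using e by (auto simp: bij_betw_def)
      have "(\<Sum>j<N. A' i j * T x j) = (\<Sum>j<N. A (e i) (e j) * g (e j) x)"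
        by (simp add: A'_def T_def)
      also have "\<dots> = (\<Sum>r\<in>S. A (e i) r * g r x)"
        by (rule sum.reindex_bij_betw[OF e])
      finally show ?thesis
        using True step[OF \<open>e i \<in> S\<close>] by (simp add: lin_step_def T_def B'_def)
    qed (simp add: lin_step_def T_def)
  qed
  then have traj: "traj (lin_step N A' B') (T x) u t = T (traj f x u t)" for x u t
    by (induction t) simp_all
  have "lin_output N C' (T x) = x" for x
  proof (rule vec_eq_iff[THEN iffD2], rule allI)
    fix i
    have "lin_output N C' (T x) $ i = (\<Sum>j<N. C i (e j) * g (e j) x)"
      by (simp add: lin_output_def C'_def T_def)
    also have "\<dots> = (\<Sum>r\<in>S. C i r * g r x)"
      by (rule sum.reindex_bij_betw[OF e])
    finally show "lin_output N C' (T x) $ i = x $ i"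
      by (simp add: state[of x i])
  qed
  then have "immersible_into f N A' B' C'"
    unfolding immersible_into_def
    by (intro bexI[of _ T]) (simp_all add: traj, simp add: T_def)
  then show ?thesis
    using assms(2) unfolding immersible_def N_def by blast
qed

text \<open>The coordinates are the components of \<open>fhat f 0 x 0, \<dots>, fhat f k x 0\<close>. For \<open>l < k\<close> the block
  \<open>l\<close> is shifted to the block \<open>l + 1\<close>, and the recurrence fills the block row \<open>k\<close>, so that \<open>A\<close> is a
  block companion matrix. An additional block \<open>l = k + 1\<close> of zeros makes the dimension exceed that
  of the original system also when \<open>k = 0\<close>.\<close>

lemma immersible_if_recurrence:
  fixes f :: "real^'n::finite \<Rightarrow> real^'m::finite \<Rightarrow> real^'n"
  assumes rec: "\<And>x. fhat f (Suc k) x 0 = (\<Sum>l\<le>k. \<alpha> l *v fhat f l x 0)"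
    and aff: "\<And>l x u. l \<le> k \<Longrightarrow> fhat f (Suc l) x u = fhat f (Suc l) x 0 + b (Suc l) *v u"
  shows "immersible f"
proof -
  define S :: "(nat \<times> 'n) set" where "S = {..Suc k} \<times> UNIV"
  define g where "g = (\<lambda>(l, i) x. if l \<le> k then fhat f l x 0 $ i else 0)"
  (* Column block k + 1 of A is multiplied by zero coordinates, so \<alpha> (k + 1) may occur there. *)
  define A where "A = (\<lambda>(l, i) (l', i').
    if l < k then of_bool (l' = Suc l \<and> i' = i) else if l = k then \<alpha> l' $ i $ i' else 0)"
  define B where "B = (\<lambda>(l, i) p. if l \<le> k then b (Suc l) $ i $ p else 0)"
  define C where "C i r = (of_bool (r = (0, i)) :: real)" for i :: 'n and r :: "nat \<times> 'n"
  have fin: "finite S" by (simp add: S_def)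
  have unit_sum: "(\<Sum>r\<in>S. of_bool (r = q) * h r) = h q" if "q \<in> S" for q and h :: "nat \<times> 'n \<Rightarrow> real"
    using sum_of_bool_eq_mult[OF fin that] .
  show ?thesis
  proof (rule immersible_if_linear_coordinates[of S g f A B C])
    show "card S > CARD('n)" by (simp add: S_def)
    show "x $ i = (\<Sum>r\<in>S. C i r * g r x)" for x i
      unfolding C_def by (subst unit_sum) (simp_all add: S_def g_def)
    fix s x u
    assume "s \<in> S"
    obtain l i where s: "s = (l, i)" by (cases s)
    have affine: "g s (f x u) = fhat f (Suc l) x 0 $ i + (\<Sum>p\<in>UNIV. B s p * u $ p)" if "l \<le> k"
      using that aff[of l x u] fhat_Suc[of f l x u]
      by (simp add: s g_def B_def matrix_vector_mult_def)
    consider "l < k" | "l = k" | "l > k" by linarith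
    then show "g s (f x u) = (\<Sum>r\<in>S. A s r * g r x) + (\<Sum>p\<in>UNIV. B s p * u $ p)"
    proof cases
      case 1
      then have "A s = (\<lambda>r. of_bool (r = (Suc l, i)))"
        by (auto simp: A_def s)
      then have "(\<Sum>r\<in>S. A s r * g r x) = g (Suc l, i) x"
        using 1 by (simp only: unit_sum) (simp add: unit_sum S_def)
      then show ?thesis using 1 affine by (simp add: g_def)
    next
      case 2
      have "(\<Sum>r\<in>S. A s r * g r x) = (\<Sum>l'\<le>Suc k. \<Sum>i'\<in>UNIV. A s (l', i') * g (l', i') x)"
        unfolding S_def sum.cartesian_product by (simp add: case_prod_unfold)
      also have "\<dots> = (\<Sum>l'\<le>k. \<Sum>i'\<in>UNIV. \<alpha> l' $ i $ i' * fhat f l' x 0 $ i')"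
        using 2 by (simp add: A_def g_def s)
      also have "\<dots> = fhat f (Suc k) x 0 $ i"
        unfolding rec by (simp add: matrix_vector_mult_def)
      finally show ?thesis using 2 affine by simp
    next
      case 3
      then have "A s r = 0" "g s y = 0" "B s p = 0" for r y p
        by (simp_all add: g_def A_def B_def s case_prod_unfold)
      then show ?thesis by simp
    qed
  qed (rule fin)
qed

theorem theorem2:
  fixes f :: "real^'n::finite \<Rightarrow> real^'m::finite \<Rightarrow> real^'n"
  assumes "continuous_on UNIV (\<lambda>(x, u). f x u)"
  shows "immersible f \<longleftrightarrow>
    (\<exists>(k::nat) (\<alpha> :: nat \<Rightarrow> real^'n^'n) (b :: nat \<Rightarrow> real^'m^'n). \<forall>x u.
      fhat f (k + 1) x 0 = (\<Sum>l=0..k. \<alpha> l *v fhat f l x 0) \<and>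
      (\<forall>l\<in>{1..k+1}. fhat f l x u = fhat f l x 0 + b l *v u))"
    (is "_ \<longleftrightarrow> ?R")
proof
  assume "immersible f"
  then obtain N A B C where "N > CARD('n)" and imm: "immersible_into f N A B C"
    unfolding immersible_def by blast
  then obtain k where N: "N = k + 1"
    by (cases N) auto
  then have range_N: "{..<N} = {0..k}" by auto
  obtain T where free: "\<And>l x i. fhat f l x 0 $ i = (\<Sum>j<N. row_power N A (C i) l j * T x j)"
    and forced: "\<And>l x u i. fhat f (Suc l) x u $ i = fhat f (Suc l) x 0 $ i +
      (\<Sum>p\<in>UNIV. (\<Sum>j<N. row_power N A (C i) l j * B j p) * u $ p)"
    by (rule immersible_into_fhat[OF imm]) (rule that)
  have "\<forall>i. \<exists>a. \<forall>j<N. row_power N A (C i) N j = (\<Sum>l<N. a l * row_power N A (C i) l j)"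
    using row_power_recurrence by blast
  then obtain a where a: "\<And>i j. j < N \<Longrightarrow>
      row_power N A (C i) N j = (\<Sum>l<N. a i l * row_power N A (C i) l j)"
    by metis
  (* Each output component i satisfies its own scalar recurrence, hence the diagonal shape. *)
  define \<alpha> :: "nat \<Rightarrow> real^'n^'n" where "\<alpha> l = (\<chi> i i'. of_bool (i' = i) * a i l)" for l
  define b :: "nat \<Rightarrow> real^'m^'n" where
    "b l = (\<chi> i p. \<Sum>j<N. row_power N A (C i) (l - 1) j * B j p)" for l
  have "fhat f N x 0 = (\<Sum>l<N. \<alpha> l *v fhat f l x 0)" for x
  proof (rule vec_eq_iff[THEN iffD2], rule allI)
    fix i
    have "fhat f N x 0 $ i = (\<Sum>j<N. (\<Sum>l<N. a i l * row_power N A (C i) l j) * T x j)"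
      by (simp add: free a)
    also have "\<dots> = (\<Sum>l<N. \<Sum>j<N. a i l * (row_power N A (C i) l j * T x j))"
      unfolding sum_distrib_right mult.assoc by (rule sum.swap)
    also have "\<dots> = (\<Sum>l<N. a i l * fhat f l x 0 $ i)"
      by (simp add: free sum_distrib_left)
    also have "\<dots> = (\<Sum>l<N. \<alpha> l *v fhat f l x 0) $ i"
      by (simp add: \<alpha>_def matrix_vector_mult_def mult.assoc)
    finally show "fhat f N x 0 $ i = (\<Sum>l<N. \<alpha> l *v fhat f l x 0) $ i" .
  qed
  moreover have "fhat f l x u = fhat f l x 0 + b l *v u" if l: "l \<in> {1..k+1}" for l x u
  proof -
    obtain l' where "l = Suc l'" using l by (cases l) auto
    then show ?thesis
      using forced[of l' x u] by (simp add: vec_eq_iff b_def matrix_vector_mult_def)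
  qed
  ultimately have "fhat f (k + 1) x 0 = (\<Sum>l=0..k. \<alpha> l *v fhat f l x 0) \<and>
      (\<forall>l\<in>{1..k+1}. fhat f l x u = fhat f l x 0 + b l *v u)" for x u
    unfolding range_N unfolding N by blast
  then show ?R by blast
next
  assume ?R
  then obtain k \<alpha> b where rec: "\<And>x. fhat f (k + 1) x 0 = (\<Sum>l=0..k. \<alpha> l *v fhat f l x 0)"
    and aff: "\<And>l x u. l \<in> {1..k+1} \<Longrightarrow> fhat f l x u = fhat f l x 0 + b l *v u"
    by blast
  show "immersible f"
  proof (rule immersible_if_recurrence)
    show "fhat f (Suc k) x 0 = (\<Sum>l\<le>k. \<alpha> l *v fhat f l x 0)" for x
      using rec[of x] unfolding atMost_atLeast0 Suc_eq_plus1 .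
    show "fhat f (Suc l) x u = fhat f (Suc l) x 0 + b (Suc l) *v u" if "l \<le> k" for l x u
      by (rule aff) (use that in simp)
  qed
qed

end
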